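(* Let $n\ge 3$ be an integer, and let $d_3(n,3)$ be the largest $d$ such that there is a ternary LCD $[n,3,d]$ code. Then $$d_3(n,3)=\begin{cases}\left\lfloor \frac{9n}{13}\right\rfloor & \text{if } n\equiv 4,7,10 \pmod{13},\\[2pt] \left\lfloor \frac{9n}{13}\right\rfloor-1 & \text{if } n\equiv 0,1,2,3,5,6,8,9,11,12 \pmod{13}.\end{cases}$$
   Context: A ternary $[n,k,d]$ code is a $k$-dimensional subspace $C$ of $\mathbb{F}_3^n$ whose minimum weight (the smallest Hamming weight of a nonzero codeword) is exactly $d$. With $C^\perp=\{x\in\mathbb{F}_3^n: x\cdot y=0 \text{ for all } y\in C\}$ for the standard inner product, $C$ is LCD (linear complementary dual) if $C\cap C^\perp=\{0\}$. *)

theory Defs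
  imports
    "Jordan_Normal_Form.VS_Connect"
    "Berlekamp_Zassenhaus.Finite_Field"
begin

text \<open>
  The type \<open>'a mod_ring\<close> is the ring of integers modulo \<open>CARD('a)\<close>, and a field if
  \<open>'a\<close> is of class \<open>prime_card\<close>. The three-element type below serves only as the index
  type that makes the modulus equal to 3; its elements carry no meaning.
\<close>

datatype three = Three0 | Three1 | Three2

lemma UNIV_three: "(UNIV :: three set) = {Three0, Three1, Three2}"
  by (auto intro: three.exhaust)

instance three :: finite
  by standard (simp add: UNIV_three)

lemma CARD_three: "CARD(three) = 3"
  by (simp add: UNIV_three)

instance three :: prime_card
proof
  have "prime (3 :: nat)" by simp
  then show "prime CARD(three)" by (simp only: CARD_three)
qed

type_synonym F3 = "three mod_ring"

text \<open>Words of length \<open>n\<close> are the elements of \<open>carrier_vec n :: F3 vec set\<close>.\<close>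

definition hamming_weight :: "F3 vec \<Rightarrow> nat" where
  "hamming_weight x = card {i. i < dim_vec x \<and> x $ i \<noteq> 0}"

text \<open>Meaningful only for finite codes with a nonzero codeword, since \<open>Min {}\<close> is unspecified.\<close>

definition min_weight :: "nat \<Rightarrow> F3 vec set \<Rightarrow> nat" where
  "min_weight n C = Min (hamming_weight ` (C - {0\<^sub>v n}))"

definition ternary_code :: "nat \<Rightarrow> nat \<Rightarrow> nat \<Rightarrow> F3 vec set \<Rightarrow> bool" where
  "ternary_code n k d C \<longleftrightarrow>
     VectorSpace.subspace class_ring C (module_vec TYPE(F3) n) \<and>
     vectorspace.dim class_ring ((module_vec TYPE(F3) n)\<lparr>carrier := C\<rparr>) = k \<and>
     min_weight n C = d"

text \<open>The dual code is the library's \<open>orthogonal_complement\<close>, taken with respect to \<open>\<bullet>\<close>.\<close>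

definition LCD :: "nat \<Rightarrow> F3 vec set \<Rightarrow> bool" where
  "LCD n C \<longleftrightarrow> C \<inter> vec_module.orthogonal_complement n C = {0\<^sub>v n}"

text \<open>
  The maximum below is over a finite set as long as \<open>0 < k\<close>, and is unspecified if no
  ternary LCD \<open>[n,k]\<close> code exists.
\<close>

definition d\<^sub>3 :: "nat \<Rightarrow> nat \<Rightarrow> nat" where
  "d\<^sub>3 n k = Max {d. \<exists>C. ternary_code n k d C \<and> LCD n C}"

end

theory Submission
  imports Defs
begin

text \<open>
  Over the field of three elements \<open>v \<bullet> v\<close> is the weight of \<open>v\<close> modulo 3, because every nonzero
  square is \<open>1\<close>. A three-dimensional code \<open>C\<close> is therefore LCD iff its weights modulo 3 form a
  nondegenerate ternary quadratic form. Such a form takes the value \<open>0\<close> at 9 of the 27 codewords,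
  and the values \<open>1\<close> and \<open>2\<close> at 6 and 12 codewords in some order
  (\<open>LCD_weight_residue_distribution\<close>). So the weights cannot all lie close to the minimum weight
  \<open>D\<close>: those in the wrong residue class exceed it by 1 or 2. On the other hand the total weight is
  at most \<open>18 * n\<close>, since a coordinate is nonzero on at most 18 codewords
  (\<open>sum_hamming_weight_le\<close>). Comparing both gives \<open>13 * D + 12 - D mod 3 \<le> 9 * n\<close>
  (\<open>LCD_dim_3_min_weight_bound\<close>), a sharpening of the averaging bound \<open>13 * D \<le> 9 * n\<close>.

  For every \<open>n \<ge> 3\<close> the largest \<open>D\<close> allowed by this inequality is attained. A list of points, as columns of a generator matrix,
  gives a code, and appending the 13 points of the projective plane of order three (the simplex
  code) adds 9 to every nonzero weight and changes no inner product. It thus suffices to treat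
  \<open>n = 3, \<dots>, 15\<close>, one length for each residue modulo 13, and a single list of 15 points has
  all its prefixes of these lengths optimal (\<open>ternary_LCD_code_exists\<close>).
\<close>

section \<open>Linear codes as finite vector spaces\<close>

text \<open>
  The size of a code determines its dimension and conversely. In the upper bound the dimension
  enters only as the number 27 of codewords; in the construction the dimension is read off from
  that number, so that no basis has to be exhibited.
\<close>

lemma (in vectorspace) card_carrier_eq_power_dim:
  assumes "finite (carrier K)" and "finite (carrier V)"
  shows "card (carrier V) = card (carrier K) ^ dim"
proof -
  have "span (carrier V) = carrier V"
    using in_own_span[of "carrier V"] span_is_subset2[of "carrier V"] by auto
  then have "fin_dim"
    unfolding fin_dim_def using assms(2) by blast
  then obtain B where B: "finite B" "basis B"
    using finite_basis_exists by blast
  then have sub: "B \<subseteq> carrier V" unfolding basis_def by blast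
  have unique: "\<exists>!a. a \<in> B \<rightarrow>\<^sub>E carrier K \<and> lincomb a B = v" if "v \<in> carrier V" for v
    using basis_criterion[OF B(1) sub] B(2) that by blast
  have closed: "lincomb a B \<in> carrier V" if "a \<in> B \<rightarrow>\<^sub>E carrier K" for a
    using that sub by (intro lincomb_closed) auto
  have "bij_betw (\<lambda>a. lincomb a B) (B \<rightarrow>\<^sub>E carrier K) (carrier V)"
    unfolding bij_betw_def
  proof
    show "inj_on (\<lambda>a. lincomb a B) (B \<rightarrow>\<^sub>E carrier K)"
      unfolding inj_on_def using unique closed by metis
    show "(\<lambda>a. lincomb a B) ` (B \<rightarrow>\<^sub>E carrier K) = carrier V"
    proof (rule Set.set_eqI)
      fix v show "v \<in> (\<lambda>a. lincomb a B) ` (B \<rightarrow>\<^sub>E carrier K) \<longleftrightarrow> v \<in> carrier V"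
        using unique[of v] closed by blast
    qed
  qed
  then have "card (B \<rightarrow>\<^sub>E carrier K) = card (carrier V)"
    by (rule bij_betw_same_card)
  with B(1) dim_basis[OF B] show ?thesis
    by (simp add: card_PiE)
qed

lemma subspace_vec_iff:
  fixes C :: "'a::field vec set"
  shows "VectorSpace.subspace class_ring C (module_vec TYPE('a) n) \<longleftrightarrow>
    C \<subseteq> carrier_vec n \<and> 0\<^sub>v n \<in> C \<and> (\<forall>u\<in>C. \<forall>v\<in>C. u + v \<in> C) \<and> (\<forall>a. \<forall>v\<in>C. a \<cdot>\<^sub>v v \<in> C)"
proof -
  interpret vec_space "TYPE('a)" n .
  show ?thesis
    unfolding VectorSpace.subspace_def submodule_def
    using module_axioms vectorspace_axioms by (auto simp: module_vec_simps)
qed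

lemma finite_carrier_vec: "finite (carrier_vec n :: 'a::finite vec set)"
proof -
  have "carrier_vec n \<subseteq> vec_of_list ` {xs :: 'a list. length xs = n}"
    by (auto intro!: image_eqI[where x = "list_of_vec _"] simp: vec_list)
  then show ?thesis
    using finite_lists_length_eq[of "UNIV :: 'a set" n] by (auto intro: finite_subset)
qed

lemma card_subspace_eq_power_dim:
  fixes C :: "'a::{field,finite} vec set"
  assumes "VectorSpace.subspace class_ring C (module_vec TYPE('a) n)"
  shows "card C = CARD('a) ^ vectorspace.dim class_ring ((module_vec TYPE('a) n)\<lparr>carrier := C\<rparr>)"
proof -
  interpret vec_space "TYPE('a)" n .
  have "finite C"
    using assms by (auto simp: subspace_vec_iff intro: finite_subset[OF _ finite_carrier_vec])
  then show ?thesis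
    using vectorspace.card_carrier_eq_power_dim[OF subspace_is_vs[OF assms]] by simp
qed

text \<open>
  A nonzero functional on a finite space takes every value equally often, because adding a
  suitable multiple of \<open>w\<close> carries any given fibre into any other.
\<close>

lemma card_fibre_linear_functional:
  fixes C :: "'a::{field,finite} vec set" and f :: "'a vec \<Rightarrow> 'a"
  assumes C: "VectorSpace.subspace class_ring C (module_vec TYPE('a) n)"
    and add: "\<And>u v. u \<in> C \<Longrightarrow> v \<in> C \<Longrightarrow> f (u + v) = f u + f v"
    and scale: "\<And>a v. v \<in> C \<Longrightarrow> f (a \<cdot>\<^sub>v v) = a * f v"
    and w: "w \<in> C" "f w \<noteq> 0"
  shows "CARD('a) * card {v \<in> C. f v = c} = card C"
proof -
  from C have carrier: "C \<subseteq> carrier_vec n"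
    and plus: "\<And>u v. u \<in> C \<Longrightarrow> v \<in> C \<Longrightarrow> u + v \<in> C"
    and smult: "\<And>a v. v \<in> C \<Longrightarrow> a \<cdot>\<^sub>v v \<in> C"
    by (auto simp: subspace_vec_iff)
  have fin: "finite C" using finite_subset[OF carrier finite_carrier_vec] .
  have le: "card {v \<in> C. f v = b} \<le> card {v \<in> C. f v = c}" for b c
  proof (rule card_inj_on_le)
    define t where "t = ((c - b) / f w) \<cdot>\<^sub>v w"
    have t: "t \<in> C" "f t = c - b"
      using w smult scale by (auto simp: t_def)
    show "(\<lambda>v. v + t) ` {v \<in> C. f v = b} \<subseteq> {v \<in> C. f v = c}"
      using t plus add by auto
    show "inj_on (\<lambda>v. v + t) {v \<in> C. f v = b}"
    proof (rule inj_onI)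
      fix u v assume uv: "u \<in> {v \<in> C. f v = b}" "v \<in> {v \<in> C. f v = b}" "u + t = v + t"
      then have "u \<in> carrier_vec n" "v \<in> carrier_vec n" "t \<in> carrier_vec n"
        using carrier t(1) by auto
      then have "u + t - t = u" "v + t - t = v" by auto
      with uv(3) show "u = v" by metis
    qed
    show "finite {v \<in> C. f v = c}" using fin by simp
  qed
  then have fibres: "card {v \<in> C. f v = b} = card {v \<in> C. f v = c}" for b
    by (simp add: antisym)
  have "card C = card (\<Union>b. {v \<in> C. f v = b})"
    by (rule arg_cong[of _ _ card]) auto
  also have "\<dots> = (\<Sum>b\<in>UNIV. card {v \<in> C. f v = b})"
    using fin by (intro card_UN_disjoint) auto
  also have "\<dots> = (\<Sum>b\<in>(UNIV :: 'a set). card {v \<in> C. f v = c})"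
    by (rule sum.cong[OF refl fibres])
  also have "\<dots> = CARD('a) * card {v \<in> C. f v = c}"
    by simp
  finally show ?thesis ..
qed

section \<open>Weights and the standard inner product over the field of three elements\<close>

lemma F3_three_eq_zero [simp]: "(3 :: F3) = 0"
  using of_nat_card_eq_0[where 'a = three] by (simp add: CARD_three)

lemma F3_two_neq_zero [simp]: "(2 :: F3) \<noteq> 0"
proof
  assume "(2 :: F3) = 0"
  moreover have "(3 :: F3) = 2 + 1" by simp
  ultimately have "(3 :: F3) = 1" by simp
  then show False by simp
qed

lemma of_nat_F3_eq_iff: "(of_nat a :: F3) = of_nat b \<longleftrightarrow> a mod 3 = b mod 3"
  using of_nat_eq_iff_cong_CHAR[where 'a = F3, of a b] by (simp add: CARD_three cong_def)

lemma UNIV_F3: "(UNIV :: F3 set) = {0, 1, -1}"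
proof -
  have "card {0, 1, -1 :: F3} = CARD(F3)"
  proof -
    have "(1 :: F3) \<noteq> -1"
      by (metis F3_two_neq_zero add_neg_numeral_special(7) add_left_cancel one_add_one)
    then show ?thesis by (simp add: CARD_three)
  qed
  then show ?thesis
    by (intro card_subset_eq[symmetric]) auto
qed

lemma F3_cases: "x = 0 \<or> x = 1 \<or> x = -1" for x :: F3
  using UNIV_F3 by blast

lemma finite_F3_code: "C \<subseteq> carrier_vec n \<Longrightarrow> finite C" for C :: "F3 vec set"
  by (rule finite_subset[OF _ finite_carrier_vec])

lemma scalar_prod_self_eq_weight: "v \<bullet> v = of_nat (hamming_weight v)" for v :: "F3 vec"
proof -
  have square: "x * x = (if x \<noteq> 0 then 1 else 0)" for x :: F3
    using F3_cases[of x] by auto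
  have "v \<bullet> v = (\<Sum>i<dim_vec v. if v $ i \<noteq> 0 then 1 else 0)"
    by (simp add: scalar_prod_def square atLeast0LessThan)
  also have "\<dots> = of_nat (card ({..<dim_vec v} \<inter> {i. v $ i \<noteq> 0}))"
    by (simp add: sum.If_cases)
  also have "{..<dim_vec v} \<inter> {i. v $ i \<noteq> 0} = {i. i < dim_vec v \<and> v $ i \<noteq> 0}" by auto
  finally show ?thesis by (simp add: hamming_weight_def)
qed

lemma sum_hamming_weight_eq_double_count:
  fixes C :: "F3 vec set"
  assumes "C \<subseteq> carrier_vec n"
  shows "(\<Sum>v\<in>C. hamming_weight v) = (\<Sum>i<n. card {v \<in> C. v $ i \<noteq> 0})"
proof -
  have fin: "finite C" by (rule finite_F3_code[OF assms])
  have "hamming_weight v = (\<Sum>i<n. if v $ i \<noteq> 0 then 1 else 0)" if "v \<in> C" for v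
  proof -
    have "{i. i < n \<and> v $ i \<noteq> 0} = {..<n} \<inter> {i. v $ i \<noteq> 0}" by auto
    moreover have "dim_vec v = n" using assms that by auto
    ultimately show ?thesis by (simp add: hamming_weight_def sum.If_cases)
  qed
  then have "(\<Sum>v\<in>C. hamming_weight v) = (\<Sum>i<n. \<Sum>v\<in>C. if v $ i \<noteq> 0 then 1 else 0)"
    by (simp add: sum.swap[of _ C])
  also have "\<dots> = (\<Sum>i<n. card {v \<in> C. v $ i \<noteq> 0})"
    using fin by (intro sum.cong) (auto simp: sum.If_cases Int_def)
  finally show ?thesis .
qed

text \<open>
  A coordinate is a linear functional, so it vanishes on all of \<open>C\<close> or on exactly a third of it.
\<close>

lemma sum_hamming_weight_le:
  fixes C :: "F3 vec set"
  assumes C: "VectorSpace.subspace class_ring C (module_vec TYPE(F3) n)"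
  shows "3 * (\<Sum>v\<in>C. hamming_weight v) \<le> 2 * n * card C"
proof -
  have carrier: "C \<subseteq> carrier_vec n" using C by (simp add: subspace_vec_iff)
  have fin: "finite C" by (rule finite_F3_code[OF carrier])
  have "3 * card {v \<in> C. v $ i \<noteq> 0} \<le> 2 * card C" if "i < n" for i
  proof (cases "\<exists>w\<in>C. w $ i \<noteq> 0")
    case True
    then obtain w where w: "w \<in> C" "w $ i \<noteq> 0" by blast
    have "3 * card {v \<in> C. v $ i = 0} = card C"
      using card_fibre_linear_functional[OF C, of "\<lambda>v. v $ i" w 0] w carrier that
      by (force simp: CARD_three)
    moreover have "card C = card {v \<in> C. v $ i = 0} + card {v \<in> C. v $ i \<noteq> 0}"
    proof -
      have "C = {v \<in> C. v $ i = 0} \<union> {v \<in> C. v $ i \<noteq> 0}" by blast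
      moreover have "card ({v \<in> C. v $ i = 0} \<union> {v \<in> C. v $ i \<noteq> 0})
          = card {v \<in> C. v $ i = 0} + card {v \<in> C. v $ i \<noteq> 0}"
        using fin by (intro card_Un_disjoint) auto
      ultimately show ?thesis by simp
    qed
    ultimately show ?thesis by simp
  next
    case False
    then have "{v \<in> C. v $ i \<noteq> 0} = {}" by blast
    then show ?thesis by (metis card.empty le0 mult_0_right)
  qed
  then have "(\<Sum>i<n. 3 * card {v \<in> C. v $ i \<noteq> 0}) \<le> (\<Sum>i<n. 2 * card C)"
    by (intro sum_mono) auto
  then show ?thesis
    by (simp add: sum_hamming_weight_eq_double_count[OF carrier] sum_distrib_left mult_ac)
qed

section \<open>The weight distribution modulo 3\<close>

text \<open>
  Translation by \<open>w\<close> turns \<open>u \<bullet> u = v \<bullet> v\<close> with \<open>u = v + w\<close> into the affine equation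
  \<open>v \<bullet> w = w \<bullet> w\<close>, since \<open>2 = -1\<close>. The LCD property says that \<open>\<lambda>v. v \<bullet> w\<close> is not identically
  zero on the code when \<open>w \<noteq> 0\<close>, so this equation has \<open>card C / 3\<close> solutions; for \<open>w = 0\<close> every
  \<open>v\<close> is a solution.
\<close>

lemma card_pairs_of_equal_norm:
  fixes C :: "F3 vec set"
  assumes C: "VectorSpace.subspace class_ring C (module_vec TYPE(F3) n)" and "LCD n C"
  shows "3 * card {(u, v). u \<in> C \<and> v \<in> C \<and> u \<bullet> u = v \<bullet> v} = card C * (card C + 2)"
proof -
  from C have carrier: "C \<subseteq> carrier_vec n" and zero: "0\<^sub>v n \<in> C"
    and plus: "\<And>u v. u \<in> C \<Longrightarrow> v \<in> C \<Longrightarrow> u + v \<in> C"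
    and smult: "\<And>a v. v \<in> C \<Longrightarrow> a \<cdot>\<^sub>v v \<in> C"
    by (auto simp: subspace_vec_iff)
  have fin: "finite C" by (rule finite_F3_code[OF carrier])
  have minus: "u - v \<in> C" if "u \<in> C" "v \<in> C" for u v
  proof -
    have "u + (-1) \<cdot>\<^sub>v v = u - v" using that carrier by auto
    then show ?thesis using plus[OF that(1) smult[OF that(2), of "-1"]] by simp
  qed
  define S where "S w = {v \<in> C. (v + w) \<bullet> (v + w) = v \<bullet> v}" for w
  have S_eq: "S w = {v \<in> C. v \<bullet> w = w \<bullet> w}" if "w \<in> C" for w
  proof -
    have "(v + w) \<bullet> (v + w) = v \<bullet> v \<longleftrightarrow> v \<bullet> w = w \<bullet> w" if "v \<in> C" for v
    proof -
      have vw: "v \<in> carrier_vec n" "w \<in> carrier_vec n"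
        using \<open>v \<in> C\<close> \<open>w \<in> C\<close> carrier by auto
      have "(v + w) \<bullet> (v + w) = v \<bullet> v + (3 * (v \<bullet> w) + (w \<bullet> w - v \<bullet> w))"
        using vw comm_scalar_prod[OF vw]
        by (simp add: add_scalar_prod_distrib[of _ n] scalar_prod_add_distrib[of _ n])
      then have "(v + w) \<bullet> (v + w) = v \<bullet> v + (w \<bullet> w - v \<bullet> w)" by simp
      then show ?thesis by (auto simp: algebra_simps)
    qed
    then show ?thesis by (auto simp: S_def)
  qed
  have card_S: "3 * card (S w) = card C" if w: "w \<in> C - {0\<^sub>v n}" for w
  proof -
    have "w \<notin> vec_module.orthogonal_complement n C"
      using w \<open>LCD n C\<close> unfolding LCD_def by blast
    then obtain y where y: "y \<in> C" "w \<bullet> y \<noteq> 0"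
      using w carrier unfolding vec_module.orthogonal_complement_def by blast
    then have "y \<bullet> w \<noteq> 0"
      using comm_scalar_prod[of w n y] w carrier by (auto simp: subset_iff)
    then have "CARD(F3) * card {v \<in> C. v \<bullet> w = w \<bullet> w} = card C"
      using y(1) w carrier
      by (intro card_fibre_linear_functional[OF C, of "\<lambda>v. v \<bullet> w" y])
        (auto simp: subset_iff add_scalar_prod_distrib[of _ n] smult_scalar_prod_distrib[of _ n])
    then show ?thesis
      using w by (simp add: S_eq CARD_three)
  qed
  have "bij_betw (\<lambda>(w, v). (v + w, v)) (SIGMA w:C. S w)
          {(u, v). u \<in> C \<and> v \<in> C \<and> u \<bullet> u = v \<bullet> v}"
  proof (rule bij_betw_byWitness[where f' = "\<lambda>(u, v). (u - v, v)"])
    show "\<forall>p\<in>(SIGMA w:C. S w). (\<lambda>(u, v). (u - v, v)) ((\<lambda>(w, v). (v + w, v)) p) = p"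
    proof -
      have "v + w - v = w" if "v \<in> carrier_vec n" "w \<in> carrier_vec n" for v w :: "F3 vec"
        using that by auto
      then show ?thesis using carrier by (auto simp: S_def)
    qed
    have cancel: "v + (u - v) = u" if "u \<in> C" "v \<in> C" for u v
    proof -
      have "u \<in> carrier_vec n" "v \<in> carrier_vec n" using that carrier by auto
      then show ?thesis by (intro eq_vecI) auto
    qed
    then show "\<forall>p\<in>{(u, v). u \<in> C \<and> v \<in> C \<and> u \<bullet> u = v \<bullet> v}.
        (\<lambda>(w, v). (v + w, v)) ((\<lambda>(u, v). (u - v, v)) p) = p"
      by auto
    show "(\<lambda>(w, v). (v + w, v)) ` (SIGMA w:C. S w)
        \<subseteq> {(u, v). u \<in> C \<and> v \<in> C \<and> u \<bullet> u = v \<bullet> v}"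
      using plus by (auto simp: S_def)
    show "(\<lambda>(u, v). (u - v, v)) ` {(u, v). u \<in> C \<and> v \<in> C \<and> u \<bullet> u = v \<bullet> v}
        \<subseteq> (SIGMA w:C. S w)"
      using minus cancel by (auto simp: S_def)
  qed
  then have "card {(u, v). u \<in> C \<and> v \<in> C \<and> u \<bullet> u = v \<bullet> v} = card (SIGMA w:C. S w)"
    by (rule bij_betw_same_card[symmetric])
  also have "\<dots> = (\<Sum>w\<in>C. card (S w))"
    using fin by (intro card_SigmaI) (auto simp: S_def)
  also have "3 * \<dots> = 3 * card (S (0\<^sub>v n)) + (\<Sum>w\<in>C - {0\<^sub>v n}. 3 * card (S w))"
    unfolding sum.remove[OF fin zero] distrib_left sum_distrib_left ..
  also have "(\<Sum>w\<in>C - {0\<^sub>v n}. 3 * card (S w)) = (card C - 1) * card C"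
    using zero fin by (simp add: card_S)
  also have "S (0\<^sub>v n) = C"
    using carrier by (auto simp: S_def subset_iff)
  finally have "3 * card {(u, v). u \<in> C \<and> v \<in> C \<and> u \<bullet> u = v \<bullet> v}
      = 3 * card C + (card C - 1) * card C" .
  moreover have "card C > 0" using zero fin card_gt_0_iff by blast
  ultimately show ?thesis by (cases "card C") (auto simp: algebra_simps)
qed

lemma even_card_fixpoint_free_involution:
  assumes "finite S" and "\<And>x. x \<in> S \<Longrightarrow> f x \<in> S \<and> f (f x) = x \<and> f x \<noteq> x"
  shows "even (card S)"
  using assms
proof (induction S rule: finite_psubset_induct)
  case (psubset S)
  show ?case
  proof (cases "S = {}")
    case False
    then obtain x where x: "x \<in> S" by blast
    then have fx: "f x \<in> S" "f (f x) = x" "f x \<noteq> x" using psubset.prems by auto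
    define T where "T = S - {x, f x}"
    have "f y \<in> T \<and> f (f y) = y \<and> f y \<noteq> y" if "y \<in> T" for y
      using that fx psubset.prems[of y] by (auto simp: T_def)
    moreover have "T \<subset> S" using x by (auto simp: T_def)
    ultimately have "even (card T)" using psubset.IH by blast
    moreover have "card S = card T + 2"
    proof -
      have "S = insert x (insert (f x) T)" using x fx by (auto simp: T_def)
      moreover have "finite T" "x \<notin> insert (f x) T" "f x \<notin> T"
        using psubset.hyps fx by (auto simp: T_def)
      ultimately show ?thesis by simp
    qed
    ultimately show ?thesis by simp
  qed simp
qed

lemma odd_solutions_sq_plus_mult_plus_sq_eq_9:
  fixes x y :: int
  assumes eq: "x * x + x * y + y * y = 9" and odd: "odd x" "odd y"
  shows "x = 3 \<and> y = -3 \<or> x = -3 \<and> y = 3"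
proof -
  have small: "\<bar>b\<bar> \<le> 3" if "a * a + a * b + b * b = 9" for a b :: int
  proof (rule ccontr)
    assume "\<not> \<bar>b\<bar> \<le> 3"
    then have "4 * 4 \<le> \<bar>b\<bar> * \<bar>b\<bar>" by (intro mult_mono) auto
    then have "16 \<le> b * b" by (simp add: abs_mult_self_eq)
    moreover have "(2 * a + b) * (2 * a + b) + 3 * (b * b) = 36"
      using that by (simp add: algebra_simps)
    moreover have "0 \<le> (2 * a + b) * (2 * a + b)" by simp
    ultimately show False by linarith
  qed
  have "\<bar>y\<bar> \<le> 3" using small[OF eq] .
  moreover have "\<bar>x\<bar> \<le> 3" using small[of y x] eq by (simp add: algebra_simps)
  ultimately have "x \<in> {-3, -2, -1, 0, 1, 2, 3}" "y \<in> {-3, -2, -1, 0, 1, 2, 3}"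
    by auto
  with odd have "x \<in> {-3, -1, 1, 3}" "y \<in> {-3, -1, 1, 3}" by auto
  then show ?thesis using eq by auto
qed

text \<open>
  The number of pairs of equal norm is the sum of the squares of the class sizes. Write the class
  sizes as \<open>9 - x - y\<close>, \<open>9 + x\<close> and \<open>9 + y\<close>; then the count of pairs becomes
  \<open>x\<^sup>2 + x * y + y\<^sup>2 = 9\<close>. Negation pairs off the vectors of nonzero norm, so \<open>x\<close> and \<open>y\<close> are odd,
  and the only solutions left are \<open>\<plusminus>(3, -3)\<close>. Geometrically, a conic in the projective plane of
  order three has four points, six exterior and three interior points, and each point stands for
  two vectors; the two cases correspond to a form and its negative.
\<close>

lemma LCD_weight_residue_distribution:
  fixes C :: "F3 vec set"
  assumes C: "VectorSpace.subspace class_ring C (module_vec TYPE(F3) n)" and LCD: "LCD n C"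
    and card: "card C = 27"
  defines "N \<equiv> \<lambda>k. card {v \<in> C. hamming_weight v mod 3 = k}"
  shows "N 0 = 9 \<and> (N 1 = 6 \<and> N 2 = 12 \<or> N 1 = 12 \<and> N 2 = 6)"
proof -
  from C have carrier: "C \<subseteq> carrier_vec n"
    and smult: "\<And>a v. v \<in> C \<Longrightarrow> a \<cdot>\<^sub>v v \<in> C"
    by (auto simp: subspace_vec_iff)
  have fin: "finite C" by (rule finite_F3_code[OF carrier])
  define R where "R k = {v \<in> C. hamming_weight v mod 3 = k}" for k
  have fin_R: "finite (R k)" for k using fin by (simp add: R_def)
  have N: "N k = card (R k)" for k by (simp add: N_def R_def)
  have residues: "{..<3 :: nat} = {0, 1, 2}" by auto
  have "C = (\<Union>k\<in>{..<3}. R k)" by (auto simp: R_def)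
  moreover have "card (\<Union>k\<in>{..<3}. R k) = (\<Sum>k<3. N k)"
    unfolding N using fin_R by (intro card_UN_disjoint) (auto simp: R_def)
  ultimately have sum: "N 0 + N 1 + N 2 = 27"
    using card by (simp add: residues)
  have "{(u, v). u \<in> C \<and> v \<in> C \<and> u \<bullet> u = v \<bullet> v} = (\<Union>k\<in>{..<3}. R k \<times> R k)"
    by (auto simp: R_def scalar_prod_self_eq_weight of_nat_F3_eq_iff)
  moreover have "card (\<Union>k\<in>{..<3}. R k \<times> R k) = (\<Sum>k<3. N k * N k)"
    unfolding N card_cartesian_product[symmetric]
    using fin_R by (intro card_UN_disjoint) (auto simp: R_def)
  ultimately have squares: "N 0 * N 0 + N 1 * N 1 + N 2 * N 2 = 261"
    using card_pairs_of_equal_norm[OF C LCD] card by (simp add: residues)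
  have "even (N k)" if "k \<noteq> 0" for k
    unfolding N
  proof (rule even_card_fixpoint_free_involution[OF fin_R, where f = "\<lambda>v. (-1) \<cdot>\<^sub>v v"])
    fix v assume "v \<in> R k"
    then have v: "v \<in> C" "hamming_weight v mod 3 = k" by (auto simp: R_def)
    have "hamming_weight ((-1) \<cdot>\<^sub>v v) = hamming_weight v"
      unfolding hamming_weight_def by (rule arg_cong[of _ _ card]) auto
    with v smult have "(-1) \<cdot>\<^sub>v v \<in> R k" by (simp add: R_def)
    moreover have "(-1) \<cdot>\<^sub>v ((-1) \<cdot>\<^sub>v v) = v" by (intro eq_vecI) auto
    moreover have "(-1) \<cdot>\<^sub>v v \<noteq> v"
    proof
      assume eq: "(-1) \<cdot>\<^sub>v v = v"
      have "v $ i = 0" if "i < dim_vec v" for i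
      proof -
        have "- (v $ i) = ((-1) \<cdot>\<^sub>v v) $ i" using that by simp
        also have "\<dots> = v $ i" by (simp only: eq)
        finally have "v $ i + v $ i = 0" by (metis add.right_inverse)
        then have "2 * v $ i = 0" by (simp only: mult_2)
        then show ?thesis by simp
      qed
      then have "{i. i < dim_vec v \<and> v $ i \<noteq> 0} = {}" by blast
      then have "hamming_weight v = 0" unfolding hamming_weight_def by (simp only: card.empty)
      with v(2) that show False by simp
    qed
    ultimately show "(-1) \<cdot>\<^sub>v v \<in> R k \<and> (-1) \<cdot>\<^sub>v ((-1) \<cdot>\<^sub>v v) = v \<and> (-1) \<cdot>\<^sub>v v \<noteq> v"
      by blast
  qed
  then have even: "even (N 1)" "even (N 2)" by simp_all
  define x y where "x = int (N 1) - 9" and "y = int (N 2) - 9"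
  have odd: "odd x" "odd y" using even by (simp_all add: x_def y_def)
  have sizes: "int (N 1) = 9 + x" "int (N 2) = 9 + y" "int (N 0) = 9 - x - y"
    using sum by (simp_all add: x_def y_def)
  have "int (N 0) * int (N 0) + int (N 1) * int (N 1) + int (N 2) * int (N 2) = 261"
    using squares by (metis of_nat_add of_nat_mult of_nat_numeral)
  then have "x * x + x * y + y * y = 9"
    unfolding sizes by (simp add: algebra_simps)
  from odd_solutions_sq_plus_mult_plus_sq_eq_9[OF this odd] sizes
  show ?thesis by auto
qed

section \<open>The upper bound\<close>

text \<open>
  A weight that is at least \<open>D\<close> and congruent to \<open>k\<close> modulo 3 is at least
  \<open>D + (k - D) mod 3\<close>; natural subtraction being truncated, \<open>k - D\<close> is written \<open>k + 2 * D\<close>.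
  Of the nonzero codewords, eight have a weight divisible by three, and the remaining eighteen
  split as \<open>6 + 12\<close>. In the better of the two cases the excess of the total weight over \<open>26 * D\<close>
  is therefore \<open>24\<close>, \<open>8 * 2 + 6\<close> or \<open>8 + 12\<close>, according to \<open>D mod 3\<close>.
\<close>

theorem LCD_dim_3_min_weight_bound:
  fixes C :: "F3 vec set"
  assumes C: "VectorSpace.subspace class_ring C (module_vec TYPE(F3) n)" and LCD: "LCD n C"
    and card: "card C = 27"
    and weight: "\<And>v. v \<in> C \<Longrightarrow> v \<noteq> 0\<^sub>v n \<Longrightarrow> D \<le> hamming_weight v"
  shows "13 * D + 12 - D mod 3 \<le> 9 * n"
proof -
  from C have carrier: "C \<subseteq> carrier_vec n" and zero: "0\<^sub>v n \<in> C"
    by (auto simp: subspace_vec_iff)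
  have fin: "finite C" by (rule finite_F3_code[OF carrier])
  define N where "N k = card {v \<in> C. hamming_weight v mod 3 = k}" for k
  define e where "e k = (k + 2 * D) mod 3" for k :: nat
  define R where "R k = {v \<in> C - {0\<^sub>v n}. hamming_weight v mod 3 = k}" for k
  have fin_R: "finite (R k)" for k using fin by (simp add: R_def)
  have weight_zero: "hamming_weight (0\<^sub>v n) = 0"
    by (simp add: hamming_weight_def)
  have "{v \<in> C. hamming_weight v mod 3 = 0} = insert (0\<^sub>v n) (R 0)"
    using zero weight_zero by (auto simp: R_def)
  moreover have "0\<^sub>v n \<notin> R 0" by (simp add: R_def)
  ultimately have R0: "N 0 = Suc (card (R 0))"
    using fin_R by (simp add: N_def)
  have R: "N k = card (R k)" if "k \<noteq> 0" for k
    unfolding N_def R_def using that weight_zero by (intro arg_cong[of _ _ card]) auto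
  have partition: "C - {0\<^sub>v n} = (\<Union>k\<in>{..<3}. R k)"
    by (auto simp: R_def)
  have lower: "D + e k \<le> hamming_weight v" if "v \<in> R k" for k v
  proof -
    have "D \<le> hamming_weight v" and k: "hamming_weight v mod 3 = k"
      using that weight by (auto simp: R_def)
    then obtain j where j: "hamming_weight v = D + j" using le_Suc_ex by blast
    have "e k = (j + 3 * D) mod 3"
      unfolding e_def k[symmetric] j by (simp add: mod_simps algebra_simps)
    also have "\<dots> = j mod 3" by simp
    also have "\<dots> \<le> j" by simp
    finally show ?thesis using j by simp
  qed
  have "(\<Sum>k<3. card (R k) * (D + e k)) = (\<Sum>k<3. \<Sum>v\<in>R k. D + e k)" by simp
  also have "\<dots> \<le> (\<Sum>k<3. \<Sum>v\<in>R k. hamming_weight v)"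
    by (intro sum_mono lower)
  also have "\<dots> = (\<Sum>v\<in>C - {0\<^sub>v n}. hamming_weight v)"
    unfolding partition using fin_R by (intro sum.UNION_disjoint[symmetric]) (auto simp: R_def)
  also have "\<dots> \<le> (\<Sum>v\<in>C. hamming_weight v)"
    using fin by (intro sum_mono2) auto
  finally have "(\<Sum>k<3. card (R k) * (D + e k)) \<le> (\<Sum>v\<in>C. hamming_weight v)" .
  also have "\<dots> \<le> 18 * n"
    using sum_hamming_weight_le[OF C] card by simp
  finally have "card (R 0) * (D + e 0) + card (R 1) * (D + e 1) + card (R 2) * (D + e 2) \<le> 18 * n"
    by (simp add: numeral_3_eq_3 numeral_2_eq_2)
  moreover have "card (R 0) = 8 \<and>
      (card (R 1) = 6 \<and> card (R 2) = 12 \<or> card (R 1) = 12 \<and> card (R 2) = 6)"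
    using LCD_weight_residue_distribution[OF C LCD card] R0 R[of 1] R[of 2]
    unfolding N_def[symmetric] by auto
  ultimately have total: "8 * (D + e 0) + 6 * (D + e 1) + 12 * (D + e 2) \<le> 18 * n \<or>
      8 * (D + e 0) + 12 * (D + e 1) + 6 * (D + e 2) \<le> 18 * n"
    by auto
  have e: "e k = (k + 2 * (D mod 3)) mod 3" for k
    unfolding e_def by (metis mod_add_right_eq mod_mult_right_eq)
  consider "D mod 3 = 0" | "D mod 3 = 1" | "D mod 3 = 2" by linarith
  then show ?thesis
  proof cases
    case 1
    then have "e 0 = 0" "e 1 = 1" "e 2 = 2" by (simp_all add: e)
    with total 1 show ?thesis by auto
  next
    case 2
    then have "e 0 = 2" "e 1 = 0" "e 2 = 1" by (simp_all add: e)
    with total 2 show ?thesis by auto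
  next
    case 3
    then have "e 0 = 1" "e 1 = 2" "e 2 = 0" by (simp_all add: e)
    with total 3 show ?thesis by auto
  qed
qed

lemma ternary_code_3_weight_ge:
  assumes "ternary_code n 3 d C"
  shows "VectorSpace.subspace class_ring C (module_vec TYPE(F3) n)" and "card C = 27"
    and "\<And>v. v \<in> C \<Longrightarrow> v \<noteq> 0\<^sub>v n \<Longrightarrow> d \<le> hamming_weight v"
proof -
  show C: "VectorSpace.subspace class_ring C (module_vec TYPE(F3) n)"
    using assms by (simp add: ternary_code_def)
  show "card C = 27"
    using card_subspace_eq_power_dim[OF C] assms by (simp add: ternary_code_def CARD_three)
  have "finite C" using C by (auto simp: subspace_vec_iff intro: finite_F3_code)
  then show "d \<le> hamming_weight v" if "v \<in> C" "v \<noteq> 0\<^sub>v n" for v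
    using assms that by (auto simp: ternary_code_def min_weight_def)
qed

section \<open>Codes from lists of points\<close>

text \<open>
  Three-dimensional codes are described by the columns of a generator matrix. A point is such a
  column, the codewords are indexed by the linear forms on the points, and the entry of a codeword
  at a column is the value of its form there.
\<close>

fun form :: "F3 \<times> F3 \<times> F3 \<Rightarrow> F3 \<times> F3 \<times> F3 \<Rightarrow> F3" where
  "form (x, y, z) (u, v, w) = x * u + y * v + z * w"

lemma form_zero [simp]: "form (0, 0, 0) p = 0"
  by (cases p) simp

definition codeword :: "(F3 \<times> F3 \<times> F3) list \<Rightarrow> F3 \<times> F3 \<times> F3 \<Rightarrow> F3 vec" where
  "codeword ps a = vec (length ps) (\<lambda>i. form a (ps ! i))"

definition weight_of :: "(F3 \<times> F3 \<times> F3) list \<Rightarrow> F3 \<times> F3 \<times> F3 \<Rightarrow> nat" where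
  "weight_of ps a = (\<Sum>p\<leftarrow>ps. if form a p = 0 then 0 else 1)"

definition gram :: "(F3 \<times> F3 \<times> F3) list \<Rightarrow> F3 \<times> F3 \<times> F3 \<Rightarrow> F3 \<times> F3 \<times> F3 \<Rightarrow> F3" where
  "gram ps a b = (\<Sum>p\<leftarrow>ps. form a p * form b p)"

lemma weight_of_append: "weight_of (ps @ qs) a = weight_of ps a + weight_of qs a"
  by (simp add: weight_of_def)

lemma gram_append: "gram (ps @ qs) a b = gram ps a b + gram qs a b"
  by (simp add: gram_def)

lemma hamming_weight_codeword: "hamming_weight (codeword ps a) = weight_of ps a"
proof -
  have "weight_of ps a = (\<Sum>i<length ps. if form a (ps ! i) = 0 then 0 else 1)"
    by (simp add: weight_of_def sum_list_sum_nth atLeast0LessThan)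
  also have "\<dots> = card ({..<length ps} \<inter> {i. form a (ps ! i) \<noteq> 0})"
    by (simp add: sum.If_cases Collect_neg_eq)
  also have "{..<length ps} \<inter> {i. form a (ps ! i) \<noteq> 0}
      = {i. i < length ps \<and> codeword ps a $ i \<noteq> 0}"
    by (auto simp: codeword_def)
  finally show ?thesis by (simp add: hamming_weight_def codeword_def)
qed

lemma scalar_prod_codeword: "codeword ps a \<bullet> codeword ps b = gram ps a b"
  by (simp add: codeword_def gram_def scalar_prod_def sum_list_sum_nth)

lemma subspace_range_codeword:
  "VectorSpace.subspace class_ring (range (codeword ps)) (module_vec TYPE(F3) (length ps))"
  unfolding subspace_vec_iff
proof (intro conjI ballI allI)
  show "range (codeword ps) \<subseteq> carrier_vec (length ps)"
    by (auto simp: codeword_def)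
  have "0\<^sub>v (length ps) = codeword ps (0, 0, 0)"
    by (intro eq_vecI) (auto simp: codeword_def split: prod.split)
  then show "0\<^sub>v (length ps) \<in> range (codeword ps)" by blast
next
  fix u v assume "u \<in> range (codeword ps)" "v \<in> range (codeword ps)"
  then obtain x y z x' y' z' where "u = codeword ps (x, y, z)" "v = codeword ps (x', y', z')"
    by force
  moreover have "form (x, y, z) p + form (x', y', z') p = form (x + x', y + y', z + z') p" for p
    by (cases p) (simp add: algebra_simps)
  ultimately have "u + v = codeword ps (x + x', y + y', z + z')"
    by (intro eq_vecI) (auto simp: codeword_def)
  then show "u + v \<in> range (codeword ps)" by blast
next
  fix c v assume "v \<in> range (codeword ps)"
  then obtain x y z where "v = codeword ps (x, y, z)" by force
  moreover have "c * form (x, y, z) p = form (c * x, c * y, c * z) p" for p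
    by (cases p) (simp add: algebra_simps)
  ultimately have "c \<cdot>\<^sub>v v = codeword ps (c * x, c * y, c * z)"
    by (intro eq_vecI) (auto simp: codeword_def)
  then show "c \<cdot>\<^sub>v v \<in> range (codeword ps)" by blast
qed

text \<open>
  Two forms with the same codeword differ by a form whose codeword has weight zero.
\<close>

lemma inj_codeword:
  assumes "\<And>a. a \<noteq> (0, 0, 0) \<Longrightarrow> 0 < weight_of ps a"
  shows "inj (codeword ps)"
proof (rule injI)
  fix a b :: "F3 \<times> F3 \<times> F3"
  obtain x y z x' y' z' where ab: "a = (x, y, z)" "b = (x', y', z')"
    by (metis prod_cases3)
  define c where "c = (x - x', y - y', z - z')"
  have diff: "form a p - form b p = form c p" for p
    by (cases p) (simp add: ab c_def algebra_simps)
  assume eq: "codeword ps a = codeword ps b"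
  have "form c (ps ! i) = 0" if "i < length ps" for i
  proof -
    have "codeword ps a $ i = codeword ps b $ i" by (simp only: eq)
    with that show ?thesis by (simp add: codeword_def diff[symmetric])
  qed
  then have "\<forall>p\<in>set ps. form c p = 0"
    by (simp only: all_set_conv_all_nth) blast
  then have "weight_of ps c = 0" by (simp add: weight_of_def)
  then have "c = (0, 0, 0)" using assms[of c] by fastforce
  then show "a = b" by (simp add: ab c_def)
qed

text \<open>
  Positive weights make the indexing of the codewords by forms injective, so that the code has 27
  elements and hence dimension three.
\<close>

lemma ternary_LCD_code_of_points:
  assumes weight: "\<And>a. a \<noteq> (0, 0, 0) \<Longrightarrow> D \<le> weight_of ps a" and "0 < D"
    and nondegenerate: "\<And>a. (\<And>b. gram ps a b = 0) \<Longrightarrow> a = (0, 0, 0)"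
  shows "\<exists>C d. D \<le> d \<and> ternary_code (length ps) 3 d C \<and> LCD (length ps) C"
proof (intro exI conjI)
  let ?n = "length ps" and ?C = "range (codeword ps)"
  have pos: "0 < weight_of ps a" if "a \<noteq> (0, 0, 0)" for a
    using weight[OF that] \<open>0 < D\<close> by simp
  have card: "card ?C = 27"
    using card_image[OF inj_codeword[OF pos]] by (simp add: CARD_three)
  have "(3 :: nat) ^ vectorspace.dim class_ring ((module_vec TYPE(F3) ?n)\<lparr>carrier := ?C\<rparr>) = 3 ^ 3"
    using card_subspace_eq_power_dim[OF subspace_range_codeword] card by (simp add: CARD_three)
  then have dim: "vectorspace.dim class_ring ((module_vec TYPE(F3) ?n)\<lparr>carrier := ?C\<rparr>) = 3"
    by (subst (asm) power_inject_exp) simp_all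
  show "ternary_code ?n 3 (min_weight ?n ?C) ?C"
    using subspace_range_codeword dim by (simp add: ternary_code_def)
  have zero: "codeword ps (0, 0, 0) = 0\<^sub>v ?n"
    by (intro eq_vecI) (auto simp: codeword_def split: prod.split)
  have "?C - {0\<^sub>v ?n} \<noteq> {}"
  proof
    assume "?C - {0\<^sub>v ?n} = {}"
    then have "card ?C \<le> card {0\<^sub>v ?n :: F3 vec}" by (intro card_mono) auto
    with card show False by simp
  qed
  moreover have "D \<le> hamming_weight v" if "v \<in> ?C - {0\<^sub>v ?n}" for v
  proof -
    from that obtain a where "v = codeword ps a" "a \<noteq> (0, 0, 0)" using zero by blast
    then show ?thesis using weight by (simp only: hamming_weight_codeword)
  qed
  ultimately show "D \<le> min_weight ?n ?C"
    unfolding min_weight_def by (subst Min_ge_iff) auto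
  show "LCD ?n ?C"
    unfolding LCD_def
  proof (rule equalityI; rule subsetI)
    fix v assume v: "v \<in> ?C \<inter> vec_module.orthogonal_complement ?n ?C"
    then obtain a where a: "v = codeword ps a" by blast
    have "v \<bullet> codeword ps b = 0" for b
      using v unfolding vec_module.orthogonal_complement_def by blast
    then have "gram ps a b = 0" for b
      by (simp only: a scalar_prod_codeword)
    then have "a = (0, 0, 0)" by (rule nondegenerate)
    then show "v \<in> {0\<^sub>v ?n}" using a zero by simp
  next
    fix v :: "F3 vec" assume "v \<in> {0\<^sub>v ?n}"
    then show "v \<in> ?C \<inter> vec_module.orthogonal_complement ?n ?C"
      using zero unfolding vec_module.orthogonal_complement_def
      by (auto simp: codeword_def intro!: range_eqI[of _ _ "(0, 0, 0)"])
  qed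
qed

section \<open>Optimal point lists\<close>

lemma F3_numeral_eq_zero_iff: "(numeral k :: F3) = 0 \<longleftrightarrow> (numeral k :: nat) mod 3 = 0"
  using of_nat_F3_eq_iff[of "numeral k" 0] by simp

lemma F3_triple_cases:
  fixes a :: "F3 \<times> F3 \<times> F3"
  obtains x y z where "a = (x, y, z)"
    and "x = 0 \<or> x = 1 \<or> x = -1" and "y = 0 \<or> y = 1 \<or> y = -1" and "z = 0 \<or> z = 1 \<or> z = -1"
proof -
  obtain x y z where "a = (x, y, z)" by (rule prod_cases3)
  then show thesis using that F3_cases[of x] F3_cases[of y] F3_cases[of z] by simp
qed

definition simplex :: "(F3 \<times> F3 \<times> F3) list" where
  "simplex = [(0, 0, 1),
    (0, 1, 0), (0, 1, 1), (0, 1, -1),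
    (1, 0, 0), (1, 0, 1), (1, 0, -1),
    (1, 1, 0), (1, 1, 1), (1, 1, -1),
    (1, -1, 0), (1, -1, 1), (1, -1, -1)]"

lemma weight_of_simplex: "a \<noteq> (0, 0, 0) \<Longrightarrow> weight_of simplex a = 9"
proof (cases a rule: F3_triple_cases)
  case 1
  assume "a \<noteq> (0, 0, 0)"
  with 1(2-4) show ?thesis
    unfolding 1(1) by (elim disjE) (simp_all add: weight_of_def simplex_def F3_numeral_eq_zero_iff)
qed

lemma gram_simplex: "gram simplex a b = 0"
proof -
  obtain x y z where a: "a = (x, y, z)" by (metis prod_cases3)
  obtain x' y' z' where b: "b = (x', y', z')" by (metis prod_cases3)
  have "gram simplex a b = 9 * (x * x' + y * y' + z * z')"
    by (simp add: gram_def simplex_def a b algebra_simps del: F3_three_eq_zero)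
  moreover have "(9 :: F3) = 0" by (simp only: F3_numeral_eq_zero_iff) simp
  ultimately show ?thesis by simp
qed

text \<open>
  This list is ordered so that each of its prefixes of length at least three has a nondegenerate
  Gram matrix and the largest minimum weight that the upper bound allows; for instance, its first
  four points are a frame of the projective plane. The full plane \<open>simplex\<close> cannot
  serve as the prefix of length 13, its Gram matrix being zero, so points are repeated instead.
\<close>

definition chain :: "(F3 \<times> F3 \<times> F3) list" where
  "chain = [(1, 0, 0), (0, 1, 0), (0, 0, 1), (1, 1, 1), (0, 1, 1), (1, 0, 1), (1, 1, 0),
    (0, 1, -1), (1, -1, -1), (1, 0, -1), (0, 0, 1), (1, 1, 0), (1, -1, 0), (0, 1, 0), (1, 0, 1)]"

lemma atLeastAtMost_3_15: "k \<in> {3..15} \<Longrightarrow> k \<in> {3, 4, 5, 6, 7, 8, 9, 10, 11, 12, 13, 14, 15}"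
  for k :: nat
  by (auto simp: numeral_eq_Suc atLeastAtMostSuc_conv)

lemma weight_of_take_chain:
  assumes "k \<in> {3..15}" and "a \<noteq> (0, 0, 0)"
  shows "2 * (k - 1) div 3 \<le> weight_of (take k chain) a"
proof -
  have "\<forall>k\<in>{3, 4, 5, 6, 7, 8, 9, 10, 11, 12, 13, 14, 15}. 2 * (k - 1) div 3 \<le> weight_of (take k chain) a"
  proof (cases a rule: F3_triple_cases)
    case 1
    from 1(2-4) assms(2) show ?thesis
      unfolding 1(1) by (elim disjE) (simp_all add: weight_of_def chain_def F3_numeral_eq_zero_iff)
  qed
  then show ?thesis using atLeastAtMost_3_15[OF assms(1)] by blast
qed

lemma nondegenerate_gram_take_chain:
  assumes "k \<in> {3..15}" and gram: "\<And>b. gram (take k chain) a b = 0"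
  shows "a = (0, 0, 0)"
proof (rule ccontr)
  assume "a \<noteq> (0, 0, 0)"
  \<comment> \<open>The three unit forms span all forms, so one of them already detects \<open>a\<close>.\<close>
  have "\<forall>k\<in>{3, 4, 5, 6, 7, 8, 9, 10, 11, 12, 13, 14, 15}.
     gram (take k chain) a (1, 0, 0) \<noteq> 0 \<or> gram (take k chain) a (0, 1, 0) \<noteq> 0 \<or>
     gram (take k chain) a (0, 0, 1) \<noteq> 0"
  proof (cases a rule: F3_triple_cases)
    case 1
    from 1(2-4) \<open>a \<noteq> (0, 0, 0)\<close> show ?thesis
      unfolding 1(1) by (elim disjE) (simp_all add: gram_def chain_def F3_numeral_eq_zero_iff)
  qed
  then show False using atLeastAtMost_3_15[OF assms(1)] gram by blast
qed

text \<open>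
  The range \<open>3, \<dots>, 15\<close> for \<open>k\<close>, rather than \<open>0, \<dots>, 12\<close>, is forced by the dimension: for \<open>q = 0\<close>
  at least three columns are needed. The weight \<open>2 * (k - 1) div 3\<close> is the largest \<open>D\<close> with
  \<open>13 * D + 12 - D mod 3 \<le> 9 * k\<close>.
\<close>

lemma ternary_LCD_code_exists:
  assumes "k \<in> {3..15}"
  shows "\<exists>C d. 9 * q + 2 * (k - 1) div 3 \<le> d \<and>
    ternary_code (13 * q + k) 3 d C \<and> LCD (13 * q + k) C"
proof -
  define copies where "copies = concat (replicate q simplex)"
  define ps where "ps = copies @ take k chain"
  have length_copies: "length copies = 13 * q"
    unfolding copies_def by (induction q) (simp_all add: simplex_def)
  have weight_copies: "weight_of copies a = 9 * q" if "a \<noteq> (0, 0, 0)" for a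
    unfolding copies_def
    by (induction q) (simp_all add: weight_of_append weight_of_simplex[OF that], simp add: weight_of_def)
  have gram_copies: "gram copies a b = 0" for a b
    unfolding copies_def
    by (induction q) (simp_all add: gram_append gram_simplex, simp add: gram_def)
  have "length ps = 13 * q + k"
    using assms by (simp add: ps_def length_copies chain_def)
  moreover have "9 * q + 2 * (k - 1) div 3 \<le> weight_of ps a" if "a \<noteq> (0, 0, 0)" for a
    using weight_of_take_chain[OF assms that] weight_copies[OF that]
    by (simp add: ps_def weight_of_append)
  moreover have "0 < 9 * q + 2 * (k - 1) div 3" using assms by auto
  moreover have "a = (0, 0, 0)" if "\<And>b. gram ps a b = 0" for a
    using that by (intro nondegenerate_gram_take_chain[OF assms])
      (simp add: ps_def gram_append gram_copies)
  ultimately show ?thesis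
    using ternary_LCD_code_of_points[of "9 * q + 2 * (k - 1) div 3" ps] by metis
qed

section \<open>The optimal minimum weight\<close>

lemma min_weight_bound_mono:
  fixes D d :: nat
  assumes "D \<le> d"
  shows "13 * D + 12 - D mod 3 \<le> 13 * d + 12 - d mod 3"
proof (cases "D = d")
  case False
  have "13 * D + 12 - D mod 3 \<le> 13 * D + 12" by simp
  also have "\<dots> \<le> 13 * d + 12 - 2" using False assms by simp
  also have "\<dots> \<le> 13 * d + 12 - d mod 3" by (intro diff_le_mono2) simp
  finally show ?thesis .
qed simp

text \<open>
  The value attained by the construction is the largest \<open>D\<close> that satisfies
  \<open>13 * D + 12 - D mod 3 \<le> 9 * (13 * q + k)\<close>: the left-hand side increases with \<open>D\<close>, and for the
  next value of \<open>D\<close> the inequality fails, which depends on \<open>k\<close> only.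
\<close>

lemma d3_dim_3_eq:
  assumes k: "k \<in> {3..15}"
  shows "d\<^sub>3 (13 * q + k) 3 = 9 * q + 2 * (k - 1) div 3"
proof -
  let ?n = "13 * q + k" and ?D = "9 * q + 2 * (k - 1) div 3"
  let ?S = "{d. \<exists>C. ternary_code ?n 3 d C \<and> LCD ?n C}"
  have upper: "d \<le> ?D" if "d \<in> ?S" for d
  proof (rule ccontr)
    assume "\<not> d \<le> ?D"
    from that obtain C where C: "ternary_code ?n 3 d C" "LCD ?n C" by blast
    have "13 * d + 12 - d mod 3 \<le> 9 * ?n"
      using LCD_dim_3_min_weight_bound[OF ternary_code_3_weight_ge(1)[OF C(1)] C(2)
          ternary_code_3_weight_ge(2,3)[OF C(1)]] .
    moreover have "9 * ?n < 13 * (?D + 1) + 12 - (?D + 1) mod 3"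
    proof -
      define f where "f = 2 * (k - 1) div 3"
      define m where "m = (f + 1) mod 3"
      have "\<forall>k\<in>{3, 4, 5, 6, 7, 8, 9, 10, 11, 12, 13, 14, 15 :: nat}.
          9 * k + (2 * (k - 1) div 3 + 1) mod 3 < 13 * (2 * (k - 1) div 3 + 1) + 12"
        by simp
      then have "9 * k + m < 13 * (f + 1) + 12"
        unfolding m_def f_def using atLeastAtMost_3_15[OF k] by (rule bspec)
      moreover have "(9 * q + f + 1) mod 3 = m"
        using mod_mult_self1[of "f + 1" "3 * q" 3] by (simp add: m_def algebra_simps)
      ultimately show ?thesis
        unfolding f_def[symmetric] less_diff_conv by simp
    qed
    moreover have "13 * (?D + 1) + 12 - (?D + 1) mod 3 \<le> 13 * d + 12 - d mod 3"
      using \<open>\<not> d \<le> ?D\<close> by (intro min_weight_bound_mono) simp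
    ultimately show False by simp
  qed
  from ternary_LCD_code_exists[OF k, of q] obtain d where "?D \<le> d" "d \<in> ?S" by blast
  with upper have "?D \<in> ?S" using antisym by blast
  moreover have "finite ?S"
    using upper finite_nat_set_iff_bounded_le by blast
  ultimately show ?thesis
    unfolding d\<^sub>3_def using upper by (intro Max_eqI) auto
qed

theorem proposition7p8:
  fixes n :: nat
  assumes "n \<ge> 3"
  shows "(n mod 13 \<in> {4, 7, 10} \<longrightarrow>
            int (d\<^sub>3 n 3) = \<lfloor>9 * real n / 13\<rfloor>) \<and>
         (n mod 13 \<in> {0, 1, 2, 3, 5, 6, 8, 9, 11, 12} \<longrightarrow>
            int (d\<^sub>3 n 3) = \<lfloor>9 * real n / 13\<rfloor> - 1)"
proof -
  \<comment> \<open>The shift by 3 puts the remainder into the range \<open>{3..15}\<close> covered by the list of points.\<close>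
  define q k where "q = (n - 3) div 13" and "k = (n - 3) mod 13 + 3"
  have n: "n = 13 * q + k"
    using assms unfolding q_def k_def by (metis add.assoc le_add_diff_inverse2 mult_div_mod_eq)
  have "(n - 3) mod 13 < 13" by simp
  then have k: "k \<in> {3..15}" unfolding k_def by auto
  have "\<forall>k\<in>{3, 4, 5, 6, 7, 8, 9, 10, 11, 12, 13, 14, 15 :: nat}.
      (k mod 13 \<in> {4, 7, 10} \<longrightarrow> 2 * (k - 1) div 3 = 9 * k div 13) \<and>
      (k mod 13 \<in> {0, 1, 2, 3, 5, 6, 8, 9, 11, 12} \<longrightarrow> 2 * (k - 1) div 3 + 1 = 9 * k div 13)"
    by simp
  then have residues: "(k mod 13 \<in> {4, 7, 10} \<longrightarrow> 2 * (k - 1) div 3 = 9 * k div 13) \<and>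
      (k mod 13 \<in> {0, 1, 2, 3, 5, 6, 8, 9, 11, 12} \<longrightarrow> 2 * (k - 1) div 3 + 1 = 9 * k div 13)"
    using atLeastAtMost_3_15[OF k] by (rule bspec)
  have mod_n: "n mod 13 = k mod 13" unfolding n by simp
  have d3: "int (d\<^sub>3 n 3) = 9 * int q + int (2 * (k - 1) div 3)"
    using d3_dim_3_eq[OF k, of q] n by simp
  have "\<lfloor>9 * real n / 13\<rfloor> = int (9 * n div 13)"
    using floor_divide_of_nat_eq[of "9 * n" 13] by simp
  also have "9 * n div 13 = 9 * q + 9 * k div 13" unfolding n by simp
  finally have floor: "\<lfloor>9 * real n / 13\<rfloor> = 9 * int q + int (9 * k div 13)" by simp
  show ?thesis
    unfolding mod_n d3 floor
  proof (intro conjI impI)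
    assume "k mod 13 \<in> {4, 7, 10}"
    with residues have "2 * (k - 1) div 3 = 9 * k div 13" by blast
    then show "9 * int q + int (2 * (k - 1) div 3) = 9 * int q + int (9 * k div 13)"
      by (rule arg_cong)
  next
    assume "k mod 13 \<in> {0, 1, 2, 3, 5, 6, 8, 9, 11, 12}"
    with residues have "2 * (k - 1) div 3 + 1 = 9 * k div 13" by blast
    then have "int (9 * k div 13) = int (2 * (k - 1) div 3) + 1" by (metis of_nat_1 of_nat_add)
    then show "9 * int q + int (2 * (k - 1) div 3) = 9 * int q + int (9 * k div 13) - 1"
      by (simp only: algebra_simps)
  qed
qed

end
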